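(* Let $T:\mathcal H\to\mathcal H$ be a forward weighted shift whose weight sequence $\{w_n\}_{n\in\mathbb N}$ satisfies $$\delta=\sup_{n\ge m\ge2}\ \sum_{k=0}^\infty\left(\frac{w_{k+m}w_{k+m+1}\cdots w_{k+n}}{w_mw_{m+1}\cdots w_n}\right)^2<\infty.$$ Then $\operatorname{Lat}T=\{\{0\},\mathcal H\}\cup\{L_n:n\ge1\}$.
   Context: $\mathbb N=\{0,1,2,\ldots\}$. $\mathcal H$ is a separable complex Hilbert space with orthonormal basis $\{e_n\}_{n\in\mathbb N}$. Given a bounded sequence $\{w_n\}_{n\in\mathbb N}$ of positive reals, the forward weighted shift is the bounded operator $T$ with $Te_n=w_ne_{n+1}$. $\operatorname{Lat}T$ is the set of all closed $T$-invariant subspaces of $\mathcal H$, and $L_n=\bigvee_{i=n}^\infty\{e_i\}$ is the closed linear span of $\{e_i:i\ge n\}$. *)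

theory Defs
  imports "HOL-Analysis.Analysis"
begin

text \<open>
  The real vector space structure, metric and topology come from \<^class>\<open>banach\<close>, so that closures,
  completeness and bounded operators are the library's; the axioms below make the scalar
  multiplication by reals the restriction of the one by complex numbers, and the norm the one of the
  inner product (linear in the first argument, conjugate-linear in the second).
\<close>

class complex_hilbert_space = banach +
  fixes scaleC :: "complex \<Rightarrow> 'a \<Rightarrow> 'a"  (infixr \<open>*\<^sub>C\<close> 75)
    and cinner :: "'a \<Rightarrow> 'a \<Rightarrow> complex"
  assumes scaleC_add_right: "c *\<^sub>C (x + y) = c *\<^sub>C x + c *\<^sub>C y"
    and scaleC_add_left: "(c + d) *\<^sub>C x = c *\<^sub>C x + d *\<^sub>C x"
    and scaleC_scaleC: "c *\<^sub>C d *\<^sub>C x = (c * d) *\<^sub>C x"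
    and scaleC_one: "1 *\<^sub>C x = x"
    and scaleC_of_real: "complex_of_real r *\<^sub>C x = r *\<^sub>R x"
    and cinner_commute: "cinner y x = cnj (cinner x y)"
    and cinner_add_left: "cinner (x + y) z = cinner x z + cinner y z"
    and cinner_scaleC_left: "cinner (c *\<^sub>C x) y = c * cinner x y"
    and cinner_ge_zero: "0 \<le> Re (cinner x x)"
    and cinner_eq_zero_iff: "cinner x x = 0 \<longleftrightarrow> x = 0"
    and norm_eq_sqrt_cinner: "norm x = sqrt (Re (cinner x x))"

global_interpretation complex_vector:
  vector_space "scaleC :: complex \<Rightarrow> 'a \<Rightarrow> 'a::complex_hilbert_space"
  by unfold_locales
    (simp_all add: scaleC_add_right scaleC_add_left scaleC_scaleC scaleC_one)

definition closed_cspan :: "'a::complex_hilbert_space set \<Rightarrow> 'a set" where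
  "closed_cspan S = closure (complex_vector.span S)"

definition orthonormal_basis :: "(nat \<Rightarrow> 'a::complex_hilbert_space) \<Rightarrow> bool" where
  "orthonormal_basis e \<longleftrightarrow>
     (\<forall>i j. cinner (e i) (e j) = (if i = j then 1 else 0)) \<and> closed_cspan (range e) = UNIV"

definition bounded_clinear :: "('a::complex_hilbert_space \<Rightarrow> 'a) \<Rightarrow> bool" where
  "bounded_clinear T \<longleftrightarrow> bounded_linear T \<and> (\<forall>c x. T (c *\<^sub>C x) = c *\<^sub>C T x)"

definition forward_weighted_shift ::
    "(nat \<Rightarrow> 'a::complex_hilbert_space) \<Rightarrow> (nat \<Rightarrow> real) \<Rightarrow> ('a \<Rightarrow> 'a) \<Rightarrow> bool" where
  "forward_weighted_shift e w T \<longleftrightarrow>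
     bounded (range w) \<and> (\<forall>n. 0 < w n) \<and>
     bounded_clinear T \<and> (\<forall>n. T (e n) = complex_of_real (w n) *\<^sub>C e (Suc n))"

definition Lat :: "('a::complex_hilbert_space \<Rightarrow> 'a) \<Rightarrow> 'a set set" where
  "Lat T = {M. complex_vector.subspace M \<and> closed M \<and> T ` M \<subseteq> M}"

definition tail_subspace :: "(nat \<Rightarrow> 'a::complex_hilbert_space) \<Rightarrow> nat \<Rightarrow> 'a set" where
  "tail_subspace e n = closed_cspan (e ` {n..})"

text \<open>Both the series and the supremum are taken in \<open>[0, \<infinity>]\<close>, so divergence means the value \<open>\<infinity>\<close>.\<close>

definition shift_delta :: "(nat \<Rightarrow> real) \<Rightarrow> ennreal" where
  "shift_delta w =
     (SUP (m, n) \<in> {(m, n). 2 \<le> m \<and> m \<le> n}.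
        \<Sum>k. ennreal (((\<Prod>i=m..n. w (k + i)) / (\<Prod>i=m..n. w i))\<^sup>2))"

end

theory Submission
  imports Defs
begin

text \<open>
  Let \<open>p\<close> be the least index of a nonzero coordinate of an element \<open>x\<close> of an invariant subspace \<open>M\<close>,
  so that \<open>M \<subseteq> L\<^sub>p\<close>. The vector \<open>T\<^sup>2 x\<close> is a multiple of some \<open>e\<^sub>q + v\<close> with \<open>q = p + 2\<close> and
  \<open>v \<in> L\<^bsub>q+1\<^esub>\<close>. Exchanging the order of summation, the hypothesis on the weights gives
  \<open>\<Sum>\<^sub>n \<parallel>T\<^sup>n v\<parallel>\<^sup>2 / \<parallel>T\<^sup>n e\<^sub>q\<parallel>\<^sup>2 \<le> \<delta> \<parallel>v\<parallel>\<^sup>2\<close>. Hence the normalised iterates of \<open>e\<^sub>q + v\<close> are quadratically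
  close to the basis vectors \<open>e\<^bsub>q+n\<^esub>\<close>, and a Paley--Wiener argument yields \<open>L\<^sub>N \<subseteq> M\<close> for some \<open>N\<close>.
  Since \<open>T\<^sup>j x \<in> M\<close> has a nonzero coordinate at \<open>p + j\<close> and vanishing ones before, descending from \<open>N\<close>
  gives \<open>L\<^sub>p \<subseteq> M\<close>.
\<close>

section \<open>Complex inner products and orthogonality\<close>

lemma cinner_zero_left [simp]: "cinner (0::'a::complex_hilbert_space) y = 0"
  using cinner_scaleC_left[of 0 0 y] by simp

lemma cinner_add_right: "cinner (x::'a::complex_hilbert_space) (y + z) = cinner x y + cinner x z"
  using cinner_add_left[of y z x] by (metis cinner_commute complex_cnj_add)

lemma cinner_scaleC_right: "cinner (x::'a::complex_hilbert_space) (c *\<^sub>C y) = cnj c * cinner x y"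
  by (metis cinner_commute cinner_scaleC_left complex_cnj_mult)

lemma cinner_scaleR_left: "cinner (r *\<^sub>R (x::'a::complex_hilbert_space)) y = of_real r * cinner x y"
  by (metis cinner_scaleC_left scaleC_of_real)

lemma cinner_minus_left: "cinner (- (x::'a::complex_hilbert_space)) y = - cinner x y"
  using cinner_scaleR_left[of "-1" x y] by simp

lemma cinner_diff_left: "cinner ((x::'a::complex_hilbert_space) - y) z = cinner x z - cinner y z"
  using cinner_add_left[of x "- y" z] by (simp add: cinner_minus_left)

lemma cinner_sum_left: "cinner (\<Sum>i\<in>F. f i) (y::'a::complex_hilbert_space) = (\<Sum>i\<in>F. cinner (f i) y)"
  by (induction F rule: infinite_finite_induct) (simp_all add: cinner_add_left)

lemma power2_norm_eq_cinner: "(norm (x::'a::complex_hilbert_space))\<^sup>2 = Re (cinner x x)"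
  by (simp add: norm_eq_sqrt_cinner cinner_ge_zero)

lemma norm_scaleC: "norm (c *\<^sub>C (x::'a::complex_hilbert_space)) = cmod c * norm x"
proof -
  have "cinner (c *\<^sub>C x) (c *\<^sub>C x) = of_real ((cmod c)\<^sup>2) * cinner x x"
    by (simp only: cinner_scaleC_left cinner_scaleC_right complex_norm_square mult_ac)
  then have "(norm (c *\<^sub>C x))\<^sup>2 = (cmod c * norm x)\<^sup>2"
    by (simp add: power2_norm_eq_cinner power_mult_distrib)
  then show ?thesis by (simp add: power2_eq_iff_nonneg)
qed

lemma bounded_linear_scaleC: "bounded_linear (\<lambda>x::'a::complex_hilbert_space. c *\<^sub>C x)"
proof (rule bounded_linear_intro[where K = "cmod c"])
  show "c *\<^sub>C r *\<^sub>R x = r *\<^sub>R c *\<^sub>C x" for r and x :: 'a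
    by (metis scaleC_of_real scaleC_scaleC mult.commute)
qed (simp_all add: scaleC_add_right norm_scaleC mult.commute)

lemma norm_add_orthogonal:
  assumes "cinner x (y::'a::complex_hilbert_space) = 0"
  shows "(norm (x + y))\<^sup>2 = (norm x)\<^sup>2 + (norm y)\<^sup>2"
proof -
  have "cinner y x = 0" using assms cinner_commute[of y x] by simp
  then show ?thesis using assms
    by (simp add: power2_norm_eq_cinner cinner_add_left cinner_add_right)
qed

lemma norm_sum_orthogonal:
  assumes "finite F" "\<And>i j. i \<in> F \<Longrightarrow> j \<in> F \<Longrightarrow> i \<noteq> j \<Longrightarrow> cinner (u i) (u j) = 0"
  shows "(norm (\<Sum>i\<in>F. u i :: 'a::complex_hilbert_space))\<^sup>2 = (\<Sum>i\<in>F. (norm (u i))\<^sup>2)"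
  using assms
proof (induction F rule: finite_induct)
  case (insert i F)
  have "cinner (\<Sum>j\<in>F. u j) (u i) = (\<Sum>j\<in>F. 0)"
    unfolding cinner_sum_left by (rule sum.cong) (use insert in auto)
  then have "cinner (\<Sum>j\<in>F. u j) (u i) = 0" by simp
  from norm_add_orthogonal[OF this] insert show ?case by (simp add: add.commute)
qed simp

text \<open>Bessel's inequality for a single unit vector: \<open>x\<close> splits orthogonally into
  its projection onto \<open>y\<close> and a remainder, so the projection has norm at most
  \<open>norm x\<close>.\<close>

lemma bounded_linear_cinner_left:
  assumes "norm (y::'a::complex_hilbert_space) = 1"
  shows "bounded_linear (\<lambda>x. cinner x y)"
proof (rule bounded_linear_intro[where K = 1])
  fix x :: 'a
  have yy: "cinner y y = 1"
    using assms power2_norm_eq_cinner[of y] cinner_commute[of y y]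
    by (simp add: complex_eq_iff)
  let ?p = "cinner x y *\<^sub>C y"
  have "cinner (x - ?p) ?p = 0"
    by (simp add: cinner_diff_left cinner_scaleC_left cinner_scaleC_right yy)
  from norm_add_orthogonal[OF this] have "(norm ?p)\<^sup>2 \<le> (norm x)\<^sup>2" by simp
  then show "norm (cinner x y) \<le> norm x * 1"
    using assms by (simp add: norm_scaleC)
qed (simp_all add: cinner_add_left cinner_scaleR_left scaleR_conv_of_real)

section \<open>Closed complex spans\<close>

lemma subspace_closure_complex:
  assumes "complex_vector.subspace (S :: 'a::complex_hilbert_space set)"
  shows "complex_vector.subspace (closure S)"
proof (rule complex_vector.subspaceI)
  show "0 \<in> closure S"
    using assms closure_subset complex_vector.subspace_0 by blast
next
  fix x y assume "x \<in> closure S" "y \<in> closure S"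
  then obtain f g where fg: "\<forall>n. f n \<in> S" "f \<longlonglongrightarrow> x" "\<forall>n. g n \<in> S" "g \<longlonglongrightarrow> y"
    by (auto simp: closure_sequential)
  then have "(\<lambda>n. f n + g n) \<longlonglongrightarrow> x + y" "\<forall>n. f n + g n \<in> S"
    using assms by (auto intro!: tendsto_add complex_vector.subspace_add)
  then show "x + y \<in> closure S" by (auto simp: closure_sequential)
next
  fix c x assume "x \<in> closure S"
  moreover have "(\<lambda>x. c *\<^sub>C x) ` closure S \<subseteq> closure ((\<lambda>x. c *\<^sub>C x) ` S)"
    by (intro bounded_linear.linear bounded_linear_scaleC closure_bounded_linear_image_subset)
  moreover have "(\<lambda>x. c *\<^sub>C x) ` S \<subseteq> S"
    using assms complex_vector.subspace_scale by blast
  ultimately show "c *\<^sub>C x \<in> closure S" using closure_mono by blast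
qed

lemma subspace_closed_cspan: "complex_vector.subspace (closed_cspan S)"
  unfolding closed_cspan_def by (intro subspace_closure_complex complex_vector.subspace_span)

lemma closed_cspan_superset: "S \<subseteq> closed_cspan S"
  unfolding closed_cspan_def using closure_subset complex_vector.span_superset by fast

lemma closed_cspan_minimal:
  assumes "S \<subseteq> M" "complex_vector.subspace M" "closed M"
  shows "closed_cspan S \<subseteq> M"
  unfolding closed_cspan_def by (intro closure_minimal complex_vector.span_minimal assms)

text \<open>Writing the sum over indices instead of vectors lets the basis vectors later be replaced
  by others with the same coefficients, or mapped by powers of \<open>T\<close>.\<close>

lemma span_image_explicit:
  assumes "x \<in> complex_vector.span (e ` A)"
  shows "\<exists>F c. finite F \<and> F \<subseteq> A \<and> (x::'a::complex_hilbert_space) = (\<Sum>i\<in>F. c i *\<^sub>C e i)"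
  using assms
proof (induction rule: complex_vector.span_induct_alt)
  case base
  show ?case by (rule exI[of _ "{}"]) simp
next
  case (step a b y)
  then obtain F c i where F: "finite F" "F \<subseteq> A" "y = (\<Sum>i\<in>F. c i *\<^sub>C e i)"
    and i: "i \<in> A" "b = e i" by blast
  \<comment> \<open>The index \<open>i\<close> may already lie in \<open>F\<close>, so
    \<open>a\<close> is added to the old coefficient; off \<open>F\<close> the old coefficient is
    read as 0.\<close>
  let ?c = "\<lambda>j. (if j = i then a else 0) + (if j \<in> F then c j else 0)"
  have "(\<Sum>j\<in>insert i F. ?c j *\<^sub>C e j)
      = (\<Sum>j\<in>insert i F. (if j = i then a *\<^sub>C e j else 0)) + (\<Sum>j\<in>insert i F. if j \<in> F then c j *\<^sub>C e j else 0)"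
    unfolding sum.distrib[symmetric] by (rule sum.cong) (auto simp: scaleC_add_left)
  also have "\<dots> = a *\<^sub>C b + y"
    using F i by (simp add: sum.If_cases Int_absorb1 subset_insertI Collect_mem_eq)
  finally show ?case
    using F(1,2) i(1) by (intro exI[of _ "insert i F"] exI[of _ ?c]) simp
qed

section \<open>The shift, its iterates and the tail subspaces\<close>

locale weighted_shift =
  fixes e :: "nat \<Rightarrow> 'a::complex_hilbert_space" and w :: "nat \<Rightarrow> real" and T :: "'a \<Rightarrow> 'a"
  assumes basis: "orthonormal_basis e" and shift: "forward_weighted_shift e w T"
begin

lemma cinner_basis: "cinner (e i) (e j) = (if i = j then 1 else 0)"
  using basis by (simp add: orthonormal_basis_def)

lemma norm_basis [simp]: "norm (e i) = 1"
  by (simp add: norm_eq_sqrt_cinner cinner_basis)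

lemma tail_zero: "tail_subspace e 0 = UNIV"
  using basis by (simp add: tail_subspace_def orthonormal_basis_def atLeast_0)

lemma weight_pos: "0 < w n"
  using shift by (simp add: forward_weighted_shift_def)

lemma bounded_linear_T: "bounded_linear T"
  and T_scaleC: "T (c *\<^sub>C x) = c *\<^sub>C T x"
  and T_basis: "T (e n) = complex_of_real (w n) *\<^sub>C e (Suc n)"
  using shift by (simp_all add: forward_weighted_shift_def bounded_clinear_def)

lemma T_add: "T (x + y) = T x + T y"
  using bounded_linear_T by (simp add: linear_simps)

lemma bounded_linear_T_pow: "bounded_linear (T ^^ n)"
  by (induction n) (auto simp: id_def comp_def intro: bounded_linear_ident bounded_linear_compose bounded_linear_T)

lemma T_pow_scaleC: "(T ^^ n) (c *\<^sub>C x) = c *\<^sub>C (T ^^ n) x"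
  by (induction n) (simp_all add: T_scaleC)

lemma T_pow_basis: "(T ^^ n) (e i) = complex_of_real (\<Prod>j<n. w (i + j)) *\<^sub>C e (i + n)"
  by (induction n) (simp_all add: scaleC_one T_scaleC T_basis scaleC_scaleC)

lemma norm_basis_sum:
  assumes "finite F" "inj_on s F"
  shows "(norm (\<Sum>i\<in>F. c i *\<^sub>C e (s i)))\<^sup>2 = (\<Sum>i\<in>F. (cmod (c i))\<^sup>2)"
  using assms
  by (subst norm_sum_orthogonal)
     (auto simp: norm_scaleC cinner_scaleC_left cinner_scaleC_right cinner_basis inj_on_eq_iff)

lemma basis_in_tail: "n \<le> i \<Longrightarrow> e i \<in> tail_subspace e n"
  unfolding tail_subspace_def using closed_cspan_superset by fastforce

lemma subspace_tail: "complex_vector.subspace (tail_subspace e n)"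
  unfolding tail_subspace_def by (rule subspace_closed_cspan)

lemma closed_tail: "closed (tail_subspace e n)"
  by (simp add: tail_subspace_def closed_cspan_def)

lemma tail_minimal:
  "(\<And>i. n \<le> i \<Longrightarrow> e i \<in> M) \<Longrightarrow> complex_vector.subspace M \<Longrightarrow> closed M \<Longrightarrow> tail_subspace e n \<subseteq> M"
  unfolding tail_subspace_def by (rule closed_cspan_minimal) auto

text \<open>The preimage of the next tail under \<open>T\<close> is a closed subspace that contains
  every \<open>e i\<close> with \<open>i\<close> \<ge> \<open>n\<close>; by minimality it contains
  the tail from \<open>n\<close>.\<close>

lemma T_tail: "x \<in> tail_subspace e n \<Longrightarrow> T x \<in> tail_subspace e (Suc n)"
proof -
  have sub: "complex_vector.subspace (T -` tail_subspace e (Suc n))"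
    using subspace_tail[of "Suc n"] bounded_linear.linear[OF bounded_linear_T]
    by (intro complex_vector.subspaceI)
       (auto simp: T_add T_scaleC linear_0 complex_vector.subspace_0
          complex_vector.subspace_add complex_vector.subspace_scale)
  have "closed (T -` tail_subspace e (Suc n))"
    by (intro closed_vimage closed_tail linear_continuous_on bounded_linear_T)
  then have "tail_subspace e n \<subseteq> T -` tail_subspace e (Suc n)"
    using sub by (intro tail_minimal)
      (auto simp: T_basis intro!: complex_vector.subspace_scale subspace_tail basis_in_tail)
  then show "x \<in> tail_subspace e n \<Longrightarrow> T x \<in> tail_subspace e (Suc n)" by auto
qed

lemma T_pow_tail: "x \<in> tail_subspace e n \<Longrightarrow> (T ^^ k) x \<in> tail_subspace e (n + k)"
  by (induction k) (auto dest: T_tail)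

lemma tail_antimono: "m \<le> n \<Longrightarrow> tail_subspace e n \<subseteq> tail_subspace e m"
  by (intro tail_minimal subspace_tail closed_tail basis_in_tail) simp

lemma bounded_linear_coord: "bounded_linear (\<lambda>x. cinner x (e i))"
  by (simp add: bounded_linear_cinner_left)

lemma tail_coord_zero:
  assumes "x \<in> tail_subspace e n" "i < n"
  shows "cinner x (e i) = 0"
proof -
  have "tail_subspace e n \<subseteq> {x. cinner x (e i) = 0}"
  proof (rule tail_minimal)
    show "closed {x. cinner x (e i) = 0}"
      by (intro closed_Collect_eq linear_continuous_on bounded_linear_coord continuous_on_const)
  qed (use assms in \<open>auto simp: cinner_basis cinner_add_left cinner_scaleC_left intro!: complex_vector.subspaceI\<close>)
  with assms show ?thesis by auto
qed

text \<open>The map \<open>?P\<close> is linear and continuous, kills \<open>e n\<close> and fixes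
  every later basis vector, so the preimage of the next tail is a closed subspace containing all
  generators.\<close>

lemma tail_diff_coord:
  assumes "x \<in> tail_subspace e n"
  shows "x - cinner x (e n) *\<^sub>C e n \<in> tail_subspace e (Suc n)" (is "?P x \<in> _")
proof -
  have bl: "bounded_linear ?P"
  proof -
    have "bounded_linear (\<lambda>x. cinner x (e n) *\<^sub>C e n)"
    proof (rule bounded_linear_compose[OF _ bounded_linear_coord[of n]])
      show "bounded_linear (\<lambda>c. c *\<^sub>C e n)"
      proof (rule bounded_linear_intro[where K = 1])
        show "(r *\<^sub>R c) *\<^sub>C e n = r *\<^sub>R c *\<^sub>C e n" for r c
          by (metis scaleC_of_real scaleC_scaleC scaleR_conv_of_real)
      qed (simp_all add: scaleC_add_left norm_scaleC)
    qed
    then show ?thesis by (intro bounded_linear_sub bounded_linear_ident)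
  qed
  note T = subspace_tail[of "Suc n"]
  have sub: "complex_vector.subspace (?P -` tail_subspace e (Suc n))"
  proof (rule complex_vector.subspaceI)
    fix x y c assume x: "x \<in> ?P -` tail_subspace e (Suc n)"
    have "?P (c *\<^sub>C x) = c *\<^sub>C ?P x"
      by (simp add: cinner_scaleC_left complex_vector.scale_right_diff_distrib scaleC_scaleC)
    then show "c *\<^sub>C x \<in> ?P -` tail_subspace e (Suc n)"
      using x T complex_vector.subspace_scale by fastforce
    assume y: "y \<in> ?P -` tail_subspace e (Suc n)"
    have "?P (x + y) = ?P x + ?P y" by (simp add: cinner_add_left scaleC_add_left)
    then show "x + y \<in> ?P -` tail_subspace e (Suc n)"
      using x y T complex_vector.subspace_add by fastforce
  qed (simp add: T complex_vector.subspace_0)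
  have "closed (?P -` tail_subspace e (Suc n))"
    by (intro closed_vimage closed_tail linear_continuous_on bl)
  with sub have "tail_subspace e n \<subseteq> ?P -` tail_subspace e (Suc n)"
  proof (intro tail_minimal)
    fix i assume "n \<le> i"
    then show "e i \<in> ?P -` tail_subspace e (Suc n)"
      by (cases "i = n") (auto simp: cinner_basis scaleC_one T complex_vector.subspace_0 intro: basis_in_tail)
  qed
  with assms show ?thesis by auto
qed

lemma in_tail_iff: "x \<in> tail_subspace e n \<longleftrightarrow> (\<forall>i<n. cinner x (e i) = 0)"
proof
  show "\<forall>i<n. cinner x (e i) = 0 \<Longrightarrow> x \<in> tail_subspace e n"
  proof (induction n)
    case (Suc n)
    then have "x \<in> tail_subspace e n" by simp
    from tail_diff_coord[OF this] Suc show ?case by simp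
  qed (simp add: tail_zero)
qed (simp add: tail_coord_zero)

text \<open>The vectors orthogonal to \<open>x\<close> form a closed subspace containing the basis,
  hence everything, \<open>x\<close> included.\<close>

lemma eq_zero_if_coords_zero:
  assumes "\<And>i. cinner x (e i) = 0"
  shows "x = 0"
proof -
  have "UNIV = closed_cspan (range e)"
    using basis by (simp add: orthonormal_basis_def)
  also have "\<dots> \<subseteq> {y. cinner y x = 0}" if "x \<noteq> 0"
  proof (rule closed_cspan_minimal)
    \<comment> \<open>Continuity of the functional is available for unit vectors only; rescaling
      \<open>x\<close> does not change the kernel.\<close>
    let ?u = "inverse (norm x) *\<^sub>R x"
    have "bounded_linear (\<lambda>y. cinner y ?u)"
      by (rule bounded_linear_cinner_left) (use that in simp)
    moreover have "cinner y ?u = 0 \<longleftrightarrow> cinner y x = 0" for y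
      using that by (simp add: cinner_scaleC_right flip: scaleC_of_real)
    ultimately show "closed {y. cinner y x = 0}"
      using closed_Collect_eq[OF linear_continuous_on continuous_on_const, of "\<lambda>y. cinner y ?u" 0]
      by simp
  qed (use assms in \<open>auto simp: cinner_add_left cinner_scaleC_left cinner_commute[of x]
      intro!: complex_vector.subspaceI\<close>)
  finally show ?thesis using cinner_eq_zero_iff[of x] by blast
qed

text \<open>Without its leading term, \<open>x\<close> lies in the tail from \<open>n + 1\<close>,
  which \<open>T\<close> sends into the tail from \<open>n + 2\<close>; only the leading term
  reaches coordinate \<open>n + 1\<close>.\<close>

lemma coord_T: "cinner (T x) (e (Suc n)) = of_real (w n) * cinner x (e n)" if "x \<in> tail_subspace e n"
proof -
  let ?c = "cinner x (e n)"
  have "T (x - ?c *\<^sub>C e n) \<in> tail_subspace e (Suc (Suc n))"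
    by (intro T_tail tail_diff_coord that)
  then have "cinner (T (x - ?c *\<^sub>C e n)) (e (Suc n)) = 0"
    by (simp add: tail_coord_zero)
  moreover have "T x = T (x - ?c *\<^sub>C e n) + ?c *\<^sub>C T (e n)"
    by (simp flip: T_add T_scaleC)
  ultimately show ?thesis
    by (simp add: cinner_add_left cinner_scaleC_left T_basis cinner_basis)
qed

lemma coord_T_pow_nonzero:
  "x \<in> tail_subspace e n \<Longrightarrow> cinner x (e n) \<noteq> 0 \<Longrightarrow> cinner ((T ^^ k) x) (e (n + k)) \<noteq> 0"
proof (induction k)
  case (Suc k)
  then show ?case using coord_T[OF T_pow_tail[of x n k]] weight_pos[of "n + k"] by simp
qed simp

section \<open>From the weight condition to a tail inside an invariant subspace\<close>

text \<open>Cross-multiplied, both sides are the product of the weights over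
  \<open>{p..<i+n}\<close>, cut once at \<open>i\<close> and once at \<open>p + n\<close>. This
  turns the ratio of the norms of \<open>(T ^^ n) (e i)\<close> and \<open>(T ^^ n) (e p)\<close>
  into the quotient squared in \<open>shift_delta\<close>.\<close>

lemma weight_ratio:
  assumes "p \<le> i"
  shows "(\<Prod>j<n. w (i + j)) / (\<Prod>j<n. w (p + j)) = (\<Prod>j=p..<i. w (n + j)) / (\<Prod>j=p..<i. w j)"
proof -
  have sh: "(\<Prod>j<n. w (k + j)) = (\<Prod>j=k..<k+n. w j)" for k
    using prod.shift_bounds_nat_ivl[of w 0 k n] by (simp add: atLeast0LessThan add.commute)
  have "(\<Prod>j=p..<i. w (n + j)) = (\<Prod>j=p+n..<i+n. w j)"
    using prod.shift_bounds_nat_ivl[of w p n i] by (simp add: add.commute)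
  moreover have "(\<Prod>j=p..<i. w j) * (\<Prod>j=i..<i+n. w j) = (\<Prod>j=p..<p+n. w j) * (\<Prod>j=p+n..<i+n. w j)"
    using assms by (simp add: prod.atLeastLessThan_concat)
  moreover have "(\<Prod>j=p..<i. w j) \<noteq> 0" "(\<Prod>j=p..<p+n. w j) \<noteq> 0"
    by (simp_all add: less_imp_neq[OF weight_pos, symmetric])
  moreover have "(\<Prod>j=i..<i+n. w j) = (\<Prod>j<n. w (i + j))" "(\<Prod>j=p..<p+n. w j) = (\<Prod>j<n. w (p + j))"
    by (simp_all only: sh)
  ultimately show ?thesis by (simp add: frac_eq_eq mult_ac)
qed

text \<open>For a finite combination of basis vectors the images under \<open>T ^^ n\<close> stay
  orthogonal, so the sums can be exchanged and each inner sum is at most \<open>D\<close>. With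
  finitely many \<open>n\<close> both sides are continuous in \<open>v\<close>, and the bound passes
  to the closure.\<close>

lemma sum_T_pow_bound:
  assumes D: "shift_delta w \<le> ennreal D" "0 \<le> D" and p: "2 \<le> p" and v: "v \<in> tail_subspace e (Suc p)"
  shows "(\<Sum>n<K. (norm ((T ^^ n) v) / (\<Prod>j<n. w (p + j)))\<^sup>2) \<le> D * (norm v)\<^sup>2"
proof -
  define g where "g i n = (\<Prod>j<n. w (i + j))" for i n
  have gpos: "0 < g i n" for i n by (simp add: g_def prod_pos weight_pos)
  have ratio: "(\<Sum>n<K. (g i n / g p n)\<^sup>2) \<le> D" if "Suc p \<le> i" for i
  proof -
    \<comment> \<open>The supremum runs over nonempty closed intervals \<open>{m..n}\<close>; here
      \<open>m = p\<close> and \<open>n = i - 1\<close>, which is why \<open>v\<close> has to start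
      strictly after \<open>p\<close>.\<close>
    have iv: "{p..<i} = {p..i - 1}" using that by auto
    have "ennreal (\<Sum>n<K. (g i n / g p n)\<^sup>2)
        = (\<Sum>k<K. ennreal (((\<Prod>j=p..i-1. w (k + j)) / (\<Prod>j=p..i-1. w j))\<^sup>2))"
      using that by (simp add: g_def weight_ratio iv)
    also have "\<dots> \<le> (\<Sum>k. ennreal (((\<Prod>j=p..i-1. w (k + j)) / (\<Prod>j=p..i-1. w j))\<^sup>2))"
      by (rule sum_le_suminf) auto
    also have "\<dots> \<le> shift_delta w"
      unfolding shift_delta_def
    proof (rule SUP_upper2)
      show "(p, i - 1) \<in> {(m, n). 2 \<le> m \<and> m \<le> n}" using p that by auto
    qed (simp only: prod.case order_refl)
    finally show ?thesis using D by (metis ennreal_le_iff order_trans)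
  qed
  let ?S = "{v. (\<Sum>n<K. (norm ((T ^^ n) v) / g p n)\<^sup>2) \<le> D * (norm v)\<^sup>2}"
  have "complex_vector.span (e ` {Suc p..}) \<subseteq> ?S"
  proof
    fix v assume "v \<in> complex_vector.span (e ` {Suc p..})"
    from span_image_explicit[OF this] obtain F c
      where F: "finite F" "F \<subseteq> {Suc p..}" and v: "v = (\<Sum>i\<in>F. c i *\<^sub>C e i)"
      by blast
    have nT: "(norm ((T ^^ n) v))\<^sup>2 = (\<Sum>i\<in>F. (cmod (c i))\<^sup>2 * (g i n)\<^sup>2)" for n
    proof -
      have "(T ^^ n) v = (\<Sum>i\<in>F. (c i * of_real (g i n)) *\<^sub>C e (i + n))"
        by (simp add: v linear_sum[OF bounded_linear.linear[OF bounded_linear_T_pow]]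
            T_pow_scaleC T_pow_basis g_def scaleC_scaleC)
      then show ?thesis
        using norm_basis_sum[OF F(1), of "\<lambda>i. i + n" "\<lambda>i. c i * of_real (g i n)"]
        by (simp add: norm_mult power_mult_distrib)
    qed
    have "(\<Sum>n<K. (norm ((T ^^ n) v) / g p n)\<^sup>2) = (\<Sum>n<K. \<Sum>i\<in>F. (cmod (c i))\<^sup>2 * (g i n / g p n)\<^sup>2)"
      by (simp add: power_divide nT sum_divide_distrib)
    also have "\<dots> = (\<Sum>i\<in>F. (cmod (c i))\<^sup>2 * (\<Sum>n<K. (g i n / g p n)\<^sup>2))"
      by (subst sum.swap) (simp add: sum_distrib_left)
    also have "\<dots> \<le> (\<Sum>i\<in>F. (cmod (c i))\<^sup>2 * D)"
      using F(2) by (intro sum_mono mult_left_mono ratio) auto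
    also have "\<dots> = D * (norm v)\<^sup>2"
      using norm_basis_sum[OF F(1), of "\<lambda>i. i" c] by (simp add: v sum_distrib_left mult.commute)
    finally show "v \<in> ?S" by simp
  qed
  moreover have "closed ?S"
    by (intro closed_Collect_le continuous_intros linear_continuous_on bounded_linear_T_pow)
       (use gpos in \<open>simp add: less_imp_neq[symmetric]\<close>)
  ultimately have "tail_subspace e (Suc p) \<subseteq> ?S"
    unfolding tail_subspace_def closed_cspan_def by (rule closure_minimal)
  with v show ?thesis by (auto simp: g_def)
qed

text \<open>Paley--Wiener: replacing each \<open>y\<^sub>n e\<^sub>n\<close> by \<open>y\<^sub>n f\<^sub>n\<close> approximates \<open>y\<close> up to half
  of its norm by an element of \<open>M\<close>; iterate on the error.\<close>

lemma tail_subset_if_quadratically_close: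
  assumes M: "complex_vector.subspace M" "closed M"
    and f: "\<And>n. N \<le> n \<Longrightarrow> f n \<in> M \<inter> tail_subspace e N"
    and close: "\<And>F. finite F \<Longrightarrow> F \<subseteq> {N..} \<Longrightarrow> (\<Sum>n\<in>F. (norm (e n - f n))\<^sup>2) \<le> (1/8)\<^sup>2"
  shows "tail_subspace e N \<subseteq> M"
proof
  let ?L = "tail_subspace e N"
  have sub: "complex_vector.subspace (M \<inter> ?L)"
    by (intro complex_vector.subspace_inter M subspace_tail)
  have half: "\<exists>g \<in> M \<inter> ?L. norm (y - g) \<le> norm y / 2" if y: "y \<in> ?L" for y
  proof (cases "y = 0")
    case True
    then show ?thesis using sub complex_vector.subspace_0 by (intro bexI[of _ 0]) auto
  next
    case False
    then have "0 < norm y / 4" by simp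
    moreover have "\<forall>\<epsilon>>0. \<exists>y' \<in> complex_vector.span (e ` {N..}). dist y' y < \<epsilon>"
      using y by (simp add: tail_subspace_def closed_cspan_def closure_approachable)
    ultimately have "\<exists>y' \<in> complex_vector.span (e ` {N..}). dist y' y < norm y / 4"
      by (simp only:)
    then obtain y' where y': "y' \<in> complex_vector.span (e ` {N..})" "dist y' y < norm y / 4"
      by blast
    from span_image_explicit[OF y'(1)] obtain F c
      where F: "finite F" "F \<subseteq> {N..}" and y'_eq: "y' = (\<Sum>i\<in>F. c i *\<^sub>C e i)"
      by blast
    define g where "g = (\<Sum>i\<in>F. c i *\<^sub>C f i)"
    have g: "g \<in> M \<inter> ?L"
      unfolding g_def using F(2) f
      by (intro complex_vector.subspace_sum[OF sub] complex_vector.subspace_scale[OF sub]) auto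
    have "y' - g = (\<Sum>i\<in>F. c i *\<^sub>C (e i - f i))"
      by (simp add: y'_eq g_def sum_subtractf complex_vector.scale_right_diff_distrib)
    then have "norm (y' - g) \<le> (\<Sum>i\<in>F. cmod (c i) * norm (e i - f i))"
      by (metis (no_types, lifting) norm_scaleC norm_sum sum.cong)
    \<comment> \<open>Cauchy--Schwarz separates the coefficients, whose norm is that of
      \<open>y'\<close>, from the distances bounded by \<open>close\<close>.\<close>
    also have "\<dots> \<le> L2_set (\<lambda>i. cmod (c i)) F * L2_set (\<lambda>i. norm (e i - f i)) F"
      using L2_set_mult_ineq[of "\<lambda>i. cmod (c i)" "\<lambda>i. norm (e i - f i)" F] by simp
    also have "L2_set (\<lambda>i. cmod (c i)) F = norm y'"
      using norm_basis_sum[OF F(1), of "\<lambda>i. i" c] by (simp add: L2_set_def y'_eq real_sqrt_unique)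
    also have "L2_set (\<lambda>i. norm (e i - f i)) F \<le> 1/8"
      unfolding L2_set_def using close[OF F] by (intro real_le_lsqrt sum_nonneg) auto
    finally have "norm (y' - g) \<le> norm y' * (1/8)" by (simp add: mult_left_mono)
    moreover have "norm y' \<le> norm y + norm y / 4"
      using y'(2) norm_triangle_sub[of y' y] by (simp add: dist_norm)
    moreover have "norm (y - g) \<le> norm (y' - y) + norm (y' - g)"
      using norm_triangle_ineq[of "y - y'" "y' - g"] by (simp add: norm_minus_commute)
    \<comment> \<open>The two errors add up to at most 1/4 + (1/8)(5/4) = 13/32 of
      \<open>norm y\<close>.\<close>
    ultimately have "norm (y - g) \<le> norm y / 2"
      using y'(2) norm_ge_zero[of y] unfolding dist_norm by linarith
    with g show ?thesis by blast
  qed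
  fix y assume y: "y \<in> ?L"
  have iter: "\<exists>g \<in> M \<inter> ?L. norm (y - g) \<le> norm y * (1/2) ^ k" for k
  proof (induction k)
    case 0
    show ?case using sub complex_vector.subspace_0 by (intro bexI[of _ 0]) auto
  next
    case (Suc k)
    then obtain g where g: "g \<in> M \<inter> ?L" "norm (y - g) \<le> norm y * (1/2) ^ k" by blast
    have "y - g \<in> ?L" using y g subspace_tail complex_vector.subspace_diff by blast
    from half[OF this] obtain h where h: "h \<in> M \<inter> ?L" "norm (y - g - h) \<le> norm (y - g) / 2" by blast
    have "g + h \<in> M \<inter> ?L" using sub g h complex_vector.subspace_add by blast
    moreover have "norm (y - (g + h)) \<le> norm y * (1/2) ^ Suc k"
      using g h by (simp add: diff_diff_eq)
    ultimately show ?case by blast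
  qed
  have "y \<in> closure M"
    unfolding closure_approachable
  proof (intro allI impI)
    fix \<epsilon> :: real assume "0 < \<epsilon>"
    have "(\<lambda>k. norm y * (1/2) ^ k) \<longlonglongrightarrow> norm y * 0"
      by (intro tendsto_mult tendsto_const LIMSEQ_power_zero) simp
    then have "\<forall>\<^sub>F k in sequentially. norm y * (1/2) ^ k < \<epsilon>"
      using \<open>0 < \<epsilon>\<close> by (intro order_tendstoD(2)) auto
    then obtain k where "norm y * (1/2) ^ k < \<epsilon>"
      by (auto simp: eventually_sequentially)
    with iter[of k] show "\<exists>g\<in>M. dist g y < \<epsilon>"
      by (force simp: dist_norm norm_minus_commute)
  qed
  then show "y \<in> M" using M by simp
qed

lemma LatD:
  assumes "M \<in> Lat T"
  shows "complex_vector.subspace M" "closed M" "x \<in> M \<Longrightarrow> (T ^^ n) x \<in> M"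
  using assms by (auto simp: Lat_def) (induction n; auto)

text \<open>Each \<open>e (p + n) + r n\<close> is a multiple of \<open>(T ^^ n) x\<close>, so it
  lies in \<open>M\<close>, and the errors \<open>r n\<close> are square summable by
  \<open>sum_T_pow_bound\<close>.\<close>

lemma tail_subset_invariant:
  assumes D: "shift_delta w < \<infinity>" and M: "M \<in> Lat T"
    and p: "2 \<le> p" and x: "x \<in> M" "x \<in> tail_subspace e p" "cinner x (e p) \<noteq> 0"
  shows "\<exists>N. tail_subspace e N \<subseteq> M"
proof -
  define g where "g n = (\<Prod>j<n. w (p + j))" for n
  have gpos: "0 < g n" for n by (simp add: g_def prod_pos weight_pos)
  let ?c = "cinner x (e p)"
  define v where "v = inverse ?c *\<^sub>C (x - ?c *\<^sub>C e p)"
  define r where "r n = of_real (inverse (g n)) *\<^sub>C (T ^^ n) v" for n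
  have v: "v \<in> tail_subspace e (Suc p)"
    unfolding v_def by (intro complex_vector.subspace_scale subspace_tail tail_diff_coord x)
  have ev: "e p + v = inverse ?c *\<^sub>C x"
    using x(3) by (simp add: v_def complex_vector.scale_right_diff_distrib scaleC_scaleC scaleC_one)
  have r: "e (p + n) + r n = of_real (inverse (g n)) *\<^sub>C inverse ?c *\<^sub>C (T ^^ n) x" for n
  proof -
    have "inverse ?c *\<^sub>C (T ^^ n) x = of_real (g n) *\<^sub>C e (p + n) + (T ^^ n) v"
      using linear_add[OF bounded_linear.linear[OF bounded_linear_T_pow[of n]], of "e p" v]
      by (simp only: ev T_pow_scaleC T_pow_basis g_def)
    then show ?thesis
      using gpos[of n]
      by (simp add: r_def scaleC_add_right scaleC_scaleC scaleC_one flip: of_real_mult of_real_inverse)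
  qed
  obtain d where d: "0 \<le> d" "shift_delta w = ennreal d"
    using D by (cases "shift_delta w") auto
  have nr: "norm (r n) = norm ((T ^^ n) v) / g n" for n
    using gpos[of n] by (simp add: r_def norm_scaleC norm_inverse divide_inverse mult.commute)
  have "summable (\<lambda>n. (norm (r n))\<^sup>2)"
    unfolding nr g_def using sum_T_pow_bound[OF _ d(1) p v] d(2)
    by (intro bounded_imp_summable[where B = "d * (norm v)\<^sup>2"]) (auto simp: lessThan_Suc_atMost[symmetric] simp del: sum.lessThan_Suc)
  \<comment> \<open>Only a remainder of the series is small enough for the approximation argument,
    so the tail obtained starts at \<open>p + n0\<close> rather than at \<open>p\<close>.\<close>
  from suminf_exist_split[OF _ this, of "(1/8)\<^sup>2"]
  obtain n0 where n0: "norm (\<Sum>i. (norm (r (i + n0)))\<^sup>2) < (1/8)\<^sup>2" by auto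
  have "tail_subspace e (p + n0) \<subseteq> M"
  proof (rule tail_subset_if_quadratically_close)
    fix n assume n: "p + n0 \<le> n"
    let ?f = "e n + r (n - p)"
    have f: "?f = of_real (inverse (g (n - p))) *\<^sub>C inverse ?c *\<^sub>C (T ^^ (n - p)) x"
      using r[of "n - p"] n by simp
    have "?f \<in> M"
      unfolding f by (intro complex_vector.subspace_scale LatD[OF M] x(1))
    moreover have "?f \<in> tail_subspace e n"
      unfolding f using n T_pow_tail[OF x(2), of "n - p"]
      by (intro complex_vector.subspace_scale subspace_tail) simp
    ultimately show "?f \<in> M \<inter> tail_subspace e (p + n0)"
      using tail_antimono[OF n] by blast
  next
    fix F assume F: "finite F" "F \<subseteq> {p + n0..}"
    have inj: "inj_on (\<lambda>n. n - (p + n0)) F"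
      using F(2) by (intro inj_on_diff_nat) auto
    have "(\<Sum>n\<in>F. (norm (e n - (e n + r (n - p))))\<^sup>2)
        = (\<Sum>i\<in>(\<lambda>n. n - (p + n0)) ` F. (norm (r (i + n0)))\<^sup>2)"
      using F(2) by (subst sum.reindex[OF inj]) (auto intro!: sum.cong simp: subset_iff)
    also have "\<dots> \<le> (\<Sum>i. (norm (r (i + n0)))\<^sup>2)"
      using F(1) \<open>summable _\<close> by (intro sum_le_suminf summable_ignore_initial_segment) auto
    also have "\<dots> \<le> (1/8)\<^sup>2" using n0 by simp
    finally show "(\<Sum>n\<in>F. (norm (e n - (e n + r (n - p))))\<^sup>2) \<le> (1/8)\<^sup>2" .
  qed (use LatD[OF M] in auto)
  then show ?thesis ..
qed

section \<open>Classification of the invariant subspaces\<close>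

text \<open>Going down one index at a time: \<open>(T ^^ k) x\<close> is a nonzero multiple of
  \<open>e (p + k)\<close> plus a vector of the next tail, which already lies in \<open>M\<close>;
  subtracting it puts \<open>e (p + k)\<close> into \<open>M\<close>.\<close>

lemma tail_descent:
  assumes M: "M \<in> Lat T" and N: "tail_subspace e (p + k) \<subseteq> M"
    and x: "x \<in> M" "x \<in> tail_subspace e p" "cinner x (e p) \<noteq> 0"
  shows "tail_subspace e p \<subseteq> M"
  using N
proof (induction k)
  case (Suc k)
  let ?y = "(T ^^ k) x" and ?n = "p + k"
  let ?c = "cinner ?y (e ?n)"
  note sub = LatD(1)[OF M]
  have yM: "?y \<in> M" by (rule LatD(3)[OF M x(1)])
  have dM: "?y - ?c *\<^sub>C e ?n \<in> M"
    using tail_diff_coord[OF T_pow_tail[OF x(2)]] Suc.prems by auto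
  have eM: "inverse ?c *\<^sub>C (?y - (?y - ?c *\<^sub>C e ?n)) \<in> M"
    by (rule complex_vector.subspace_scale[OF sub complex_vector.subspace_diff[OF sub yM dM]])
  have "inverse ?c *\<^sub>C (?y - (?y - ?c *\<^sub>C e ?n)) = e ?n"
    using coord_T_pow_nonzero[OF x(2,3), of k] by (simp add: scaleC_scaleC scaleC_one)
  with eM have "e ?n \<in> M" by (simp only:)
  moreover have "e i \<in> M" if "Suc ?n \<le> i" for i
    using Suc.prems basis_in_tail[OF that] by auto
  ultimately have "e i \<in> M" if "?n \<le> i" for i
    using that by (cases "i = ?n") auto
  then show ?case
    by (intro Suc.IH tail_minimal LatD[OF M])
qed simp

lemma tail_in_Lat: "tail_subspace e n \<in> Lat T"
  unfolding Lat_def using subspace_tail closed_tail T_tail tail_antimono[of n "Suc n"] by auto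

lemma Lat_nonzero_is_tail:
  assumes D: "shift_delta w < \<infinity>" and M: "M \<in> Lat T" "M \<noteq> {0}"
  shows "\<exists>p. M = tail_subspace e p"
proof -
  \<comment> \<open>Minimality of \<open>p\<close> gives the inclusion of \<open>M\<close> in the
    tail from \<open>p\<close>; a witness \<open>x\<close> attaining \<open>p\<close> gives the
    converse.\<close>
  define p where "p = (LEAST i. \<exists>x\<in>M. cinner x (e i) \<noteq> 0)"
  have "\<exists>i. \<exists>x\<in>M. cinner x (e i) \<noteq> 0"
  proof (rule ccontr)
    assume "\<not> ?thesis"
    then have "M \<subseteq> {0}" using eq_zero_if_coords_zero by blast
    then show False using M LatD(1)[OF M(1)] complex_vector.subspace_0 by blast
  qed
  then have "\<exists>x\<in>M. cinner x (e p) \<noteq> 0" unfolding p_def by (rule LeastI_ex)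
  then obtain x where x: "x \<in> M" "cinner x (e p) \<noteq> 0" by blast
  have sub: "M \<subseteq> tail_subspace e p"
    unfolding in_tail_iff subset_iff p_def using not_less_Least by blast
  then have xp: "x \<in> tail_subspace e p" using x by blast
  \<comment> \<open>The hypothesis only controls the weights from index 2 on, hence the passage to \<open>T\<^sup>2 x\<close>.\<close>
  obtain N where "tail_subspace e N \<subseteq> M"
    using tail_subset_invariant[OF D M(1), of "p + 2" "(T ^^ 2) x"]
      LatD(3)[OF M(1) x(1)] T_pow_tail[OF xp, of 2] coord_T_pow_nonzero[OF xp x(2), of 2] by auto
  \<comment> \<open>The descent starts at an index of the form \<open>p + k\<close>; enlarging
    \<open>N\<close> to \<open>p + N\<close> only shrinks the tail.\<close>
  then have "tail_subspace e (p + N) \<subseteq> M" using tail_antimono[of N "p + N"] by auto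
  from tail_descent[OF M(1) this x(1) xp x(2)] sub show ?thesis by blast
qed

end

theorem theorem3p6:
  fixes e :: "nat \<Rightarrow> 'a::complex_hilbert_space"
    and w :: "nat \<Rightarrow> real"
    and T :: "'a \<Rightarrow> 'a"
  assumes "orthonormal_basis e"
    and "forward_weighted_shift e w T"
    and "shift_delta w < \<infinity>"
  shows "Lat T = {{0}, UNIV} \<union> {tail_subspace e n | n. 1 \<le> n}"
proof -
  interpret weighted_shift e w T using assms by unfold_locales
  have "{0} \<in> Lat T"
    using bounded_linear.linear[OF bounded_linear_T]
    by (auto simp: Lat_def linear_0 complex_vector.subspace_single_0)
  moreover have "M \<in> {{0}, UNIV} \<union> {tail_subspace e n | n. 1 \<le> n}" if M: "M \<in> Lat T" for M
  proof (cases "M = {0}")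
    case False
    then obtain p where "M = tail_subspace e p"
      using Lat_nonzero_is_tail[OF assms(3) M] by blast
    \<comment> \<open>Index 0 gives the whole space, which is listed separately from the tails with
      index at least 1.\<close>
    then show ?thesis using tail_zero by (cases "p = 0") auto
  qed simp
  ultimately show ?thesis
    using tail_in_Lat tail_in_Lat[of 0] unfolding tail_zero by auto
qed

end
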